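(* Let $\mathcal{G}$ be a marked PEO-graph with countable vertex set $I$ and a perfect elimination ordering $\le$, and let $\mathbf{m}\in\mathbb{Z}_+^I$ have finite support. Then $${_{\mathbf{m}}\Pi^{\mathrm{mark}}_\mathcal{G}}(q)=\sum_{\boldsymbol{\lambda}\in S(\mathbf m)}\prod _{j\in \mathrm{supp}(\mathbf{m})} \binom{q-b^{\boldsymbol{\lambda}}_{j}}{\ell(\boldsymbol{\lambda}_{j})} \frac{\ell(\boldsymbol{\lambda}_{j})!}{\prod_{k=1}^{\infty}(d^{\boldsymbol{\lambda}_{j}}_{k}!)},\qquad b^{\boldsymbol{\lambda}}_{j}=\sum_{i\in \mathcal{G}_j\setminus\{j\}}\ell(\boldsymbol{\lambda}_{i}).$$
   Context: $\mathcal{G}$ is a simple graph with edge set $E$ and marking $I_1^{\mathrm{it}}\subseteq I_1\subseteq I$ (vertices of $I_1^{\mathrm{it}}$ odd isotropic). A total order $\le$ on $I$ is a perfect elimination ordering if for each $k\in I$ the set $\mathcal{G}_k=\{r\in I\setminus\{k\}:(r,k)\in E,\ r<k\}\cup\{k\}$ is finite and spans a complete subgraph; a PEO-graph is a graph admitting such an ordering (here $\mathcal{G}_j$ refers to the fixed ordering). ${_{\mathbf{m}}\Pi^{\mathrm{mark}}_\mathcal{G}}(q)$ (for $q\in\mathbb{N}$) is the number of maps $\Gamma$ from $I$ to finite multisubsets of $\{1,\dots,q\}$ with $\Gamma(i)$ a set for $i\notin I_1^{\mathrm{it}}$, $|\Gamma(i)|=m_i$ (with multiplicity), and $\Gamma(i)\cap\Gamma(j)=\emptyset$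 for adjacent $i,j$. For a partition $\lambda$, $\ell(\lambda)$ is its number of parts and $d_k^{\lambda}$ the number of parts equal to $k$. $S(\mathbf{m})$ is the set of tuples $\boldsymbol{\lambda}=(\boldsymbol{\lambda}_i)_{i\in I}$ with $\boldsymbol{\lambda}_i$ a partition of $m_i$ (empty if $m_i=0$, of length $0$) and $\boldsymbol{\lambda}_i=(1^{m_i})$ for all $i\notin I_1^{\mathrm{it}}$. *)

theory Defs
  imports "HOL-Analysis.Analysis" "HOL-Library.Multiset"
begin

text \<open>Edges are ordered pairs: an undirected edge between \<open>i\<close> and \<open>j\<close> contributes both \<open>(i, j)\<close> and
  \<open>(j, i)\<close>. The vertex set may be infinite.\<close>

definition simple_graph :: "'a set \<Rightarrow> ('a \<times> 'a) set \<Rightarrow> bool" where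
  "simple_graph I E \<longleftrightarrow> E \<subseteq> I \<times> I \<and> sym E \<and> irrefl E"

definition marked_graph :: "'a set \<Rightarrow> ('a \<times> 'a) set \<Rightarrow> 'a set \<Rightarrow> 'a set \<Rightarrow> bool" where
  "marked_graph I E I1 I1it \<longleftrightarrow> simple_graph I E \<and> I1it \<subseteq> I1 \<and> I1 \<subseteq> I"

definition spans_complete :: "('a \<times> 'a) set \<Rightarrow> 'a set \<Rightarrow> bool" where
  "spans_complete E A \<longleftrightarrow> (\<forall>x\<in>A. \<forall>y\<in>A. x \<noteq> y \<longrightarrow> (x, y) \<in> E)"

text \<open>The set \<open>\<G>\<^sub>k\<close>; the relation \<open>le\<close> is the non-strict order, and \<open>r < k\<close> is strict because
  \<open>r \<noteq> k\<close>.\<close>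

definition elim_clique :: "'a set \<Rightarrow> ('a \<times> 'a) set \<Rightarrow> 'a rel \<Rightarrow> 'a \<Rightarrow> 'a set" where
  "elim_clique I E le k = {r \<in> I - {k}. (r, k) \<in> E \<and> (r, k) \<in> le} \<union> {k}"

definition perfect_elimination_ordering :: "'a set \<Rightarrow> ('a \<times> 'a) set \<Rightarrow> 'a rel \<Rightarrow> bool" where
  "perfect_elimination_ordering I E le \<longleftrightarrow>
     linear_order_on I le \<and>
     (\<forall>k\<in>I. finite (elim_clique I E le k) \<and> spans_complete E (elim_clique I E le k))"

definition supp_on :: "'a set \<Rightarrow> ('a \<Rightarrow> nat) \<Rightarrow> 'a set" where
  "supp_on I m = {i \<in> I. m i \<noteq> 0}"

definition marked_multicolorings ::
  "'a set \<Rightarrow> ('a \<times> 'a) set \<Rightarrow> 'a set \<Rightarrow> ('a \<Rightarrow> nat) \<Rightarrow> nat \<Rightarrow> ('a \<Rightarrow> nat multiset) set" where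
  "marked_multicolorings I E I1it m q =
     {\<Gamma> \<in> I \<rightarrow>\<^sub>E {M. set_mset M \<subseteq> {1..q}}.
        (\<forall>i\<in>I - I1it. \<forall>c. count (\<Gamma> i) c \<le> 1) \<and>
        (\<forall>i\<in>I. size (\<Gamma> i) = m i) \<and>
        (\<forall>i\<in>I. \<forall>j\<in>I. (i, j) \<in> E \<longrightarrow> set_mset (\<Gamma> i) \<inter> set_mset (\<Gamma> j) = {})}"

definition marked_chromatic ::
  "'a set \<Rightarrow> ('a \<times> 'a) set \<Rightarrow> 'a set \<Rightarrow> ('a \<Rightarrow> nat) \<Rightarrow> nat \<Rightarrow> nat" where
  "marked_chromatic I E I1it m q = card (marked_multicolorings I E I1it m q)"

text \<open>A partition is the multiset of its parts, so its length is its \<open>size\<close> and the number of parts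
  equal to \<open>k\<close> is its \<open>count\<close> at \<open>k\<close>.\<close>

definition partitions_of :: "nat \<Rightarrow> nat multiset set" where
  "partitions_of n = {p. 0 \<notin># p \<and> sum_mset p = n}"

definition partition_tuples :: "'a set \<Rightarrow> 'a set \<Rightarrow> ('a \<Rightarrow> nat) \<Rightarrow> ('a \<Rightarrow> nat multiset) set" where
  "partition_tuples I I1it m =
     {L \<in> (\<Pi>\<^sub>E i\<in>I. partitions_of (m i)). \<forall>i\<in>I - I1it. L i = replicate_mset (m i) 1}"

definition clique_length_sum ::
  "'a set \<Rightarrow> ('a \<times> 'a) set \<Rightarrow> 'a rel \<Rightarrow> ('a \<Rightarrow> nat multiset) \<Rightarrow> 'a \<Rightarrow> nat" where
  "clique_length_sum I E le L j = (\<Sum>i\<in>elim_clique I E le j - {j}. size (L i))"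

end

theory Submission
  imports Defs "HOL-Combinatorics.Multiset_Permutations"
begin

text \<open>Recording the multiplicities of the colours used at each vertex attaches to every colouring a
  tuple of partitions, so it suffices to count the colourings of a given type. Colour the support of
  \<open>m\<close> in increasing order: when \<open>j\<close> is reached, its earlier neighbours form a clique, so their colour
  sets are disjoint and exactly \<open>b\<^sub>j\<close> colours are blocked, whatever choices were made before. If some
  \<open>q - b\<^sub>j\<close> is negative there is no partial colouring at that stage, and an earlier factor
  vanishes.\<close>

section \<open>Multiplicity types of multisets\<close>

text \<open>Only elements that occur are counted, so no part is 0 and the result is a partition of
  \<open>size M\<close>, whose length is the number of distinct elements.\<close>

definition multiplicity_type :: "'c multiset \<Rightarrow> nat multiset" where
  "multiplicity_type M = image_mset (count M) (mset_set (set_mset M))"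

lemma size_multiplicity_type: "size (multiplicity_type M) = card (set_mset M)"
  by (simp add: multiplicity_type_def)

lemma zero_notin_multiplicity_type: "0 \<notin># multiplicity_type M"
  by (auto simp: multiplicity_type_def count_eq_zero_iff)

lemma sum_multiplicity_type: "sum_mset (multiplicity_type M) = size M"
  by (simp add: multiplicity_type_def size_multiset_overloaded_eq sum_unfold_sum_mset)

lemma multiplicity_type_empty_iff: "multiplicity_type M = {#} \<longleftrightarrow> M = {#}"
  by (auto simp: multiplicity_type_def mset_set_empty_iff)

text \<open>Being a set is visible from the type alone. This translates the condition on colourings
  at vertices outside \<open>I1it\<close> into the condition on partition tuples there.\<close>

lemma multiplicity_type_eq_replicate_iff:
  "multiplicity_type M = replicate_mset n 1 \<longleftrightarrow> size M = n \<and> (\<forall>c. count M c \<le> 1)"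
proof
  assume *: "multiplicity_type M = replicate_mset n 1"
  then have "size M = n"
    using sum_multiplicity_type[of M] by simp
  moreover have "count M c \<le> 1" for c
  proof (cases "c \<in># M")
    case True
    then have "count M c \<in># multiplicity_type M"
      by (simp add: multiplicity_type_def)
    then show ?thesis
      using * by (simp split: if_splits)
  next
    case False
    then show ?thesis
      by (simp add: not_in_iff)
  qed
  ultimately show "size M = n \<and> (\<forall>c. count M c \<le> 1)" by blast
next
  assume *: "size M = n \<and> (\<forall>c. count M c \<le> 1)"
  have "multiplicity_type M = image_mset (\<lambda>_. 1) (mset_set (set_mset M))"
    unfolding multiplicity_type_def
  proof (rule image_mset_cong)
    fix x assume "x \<in># mset_set (set_mset M)"
    then show "count M x = 1"
      using * by (simp add: le_antisym Suc_le_eq)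
  qed
  then have r: "multiplicity_type M = replicate_mset (card (set_mset M)) 1"
    by (simp add: image_mset_const_eq)
  then have "card (set_mset M) = n"
    using sum_multiplicity_type[of M] * by simp
  with r show "multiplicity_type M = replicate_mset n 1" by simp
qed

section \<open>Counting multisets of a given type\<close>

text \<open>List \<open>B\<close> without repetition. A multiset with support \<open>B\<close> is
  then the same as its word of multiplicities, and having type \<open>p\<close> means that this word
  is an arrangement of the parts of \<open>p\<close>.\<close>

lemma card_multisets_with_support_and_type:
  assumes "finite B" "card B = size p" "0 \<notin># p"
  shows "card {M. set_mset M = B \<and> multiplicity_type M = p} = card (permutations_of_multiset p)"
proof -
  obtain xs where xs: "set xs = B" "distinct xs"
    using finite_distinct_list[OF assms(1)] by blast
  have len: "length xs = size p"
    using xs assms(2) distinct_card by fastforce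
  have mset_xs: "mset xs = mset_set B"
    using xs mset_set_set by metis
  have "bij_betw (\<lambda>M. map (count M) xs) {M. set_mset M = B \<and> multiplicity_type M = p}
    (permutations_of_multiset p)"
  proof (rule bij_betw_imageI)
    show "inj_on (\<lambda>M. map (count M) xs) {M. set_mset M = B \<and> multiplicity_type M = p}"
    proof (rule inj_onI)
      fix M N
      assume M: "M \<in> {M. set_mset M = B \<and> multiplicity_type M = p}"
        and N: "N \<in> {M. set_mset M = B \<and> multiplicity_type M = p}"
        and eq: "map (count M) xs = map (count N) xs"
      show "M = N"
      proof (rule multiset_eqI)
        fix x
        show "count M x = count N x"
        proof (cases "x \<in> B")
          case True
          then show ?thesis using eq xs by simp
        next
          case False
          then show ?thesis using M N by (auto simp: not_in_iff)
        qed
      qed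
    qed
    show "(\<lambda>M. map (count M) xs) ` {M. set_mset M = B \<and> multiplicity_type M = p} =
      permutations_of_multiset p"
    proof (intro equalityI subsetI)
      fix ys assume "ys \<in> (\<lambda>M. map (count M) xs) ` {M. set_mset M = B \<and> multiplicity_type M = p}"
      then show "ys \<in> permutations_of_multiset p"
        by (auto simp: permutations_of_multiset_def multiplicity_type_def mset_xs)
    next
      fix ys assume "ys \<in> permutations_of_multiset p"
      then have ys: "mset ys = p" by (simp add: permutations_of_multiset_def)
      then have len_ys: "length ys = length xs" using len by auto
      \<comment> \<open>The inverse map: the \<open>i\<close>-th element of \<open>B\<close> is
        taken as often as the \<open>i\<close>-th letter of the word says.\<close>
      define M where "M = (\<Sum>i<length xs. replicate_mset (ys ! i) (xs ! i))"
      have cnt: "count M (xs ! i) = ys ! i" if "i < length xs" for i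
      proof -
        \<comment> \<open>As \<open>xs\<close> is distinct, only the summand \<open>j = i\<close>
          contributes.\<close>
        have "count M (xs ! i) = (\<Sum>j<length xs. if j = i then ys ! i else 0)"
          unfolding M_def count_sum using xs(2) that
          by (intro sum.cong) (auto simp: nth_eq_iff_index_eq)
        then show ?thesis using that by simp
      qed
      have map_M: "map (count M) xs = ys"
        using cnt len_ys by (intro nth_equalityI) auto
      \<comment> \<open>Positivity of the parts makes the support all of \<open>B\<close>, not just
        a subset.\<close>
      have pos: "ys ! i \<noteq> 0" if "i < length xs" for i
        using assms(3) ys len_ys that by (metis nth_mem_mset)
      have "set_mset M = B"
      proof (intro equalityI subsetI)
        fix x assume "x \<in># M"
        then show "x \<in> B"
          using xs by (auto simp: M_def set_mset_sum split: if_splits)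
      next
        fix x assume "x \<in> B"
        then obtain i where "i < length xs" "x = xs ! i"
          using xs by (metis in_set_conv_nth)
        then show "x \<in># M"
          using cnt pos by (metis count_eq_zero_iff)
      qed
      moreover from this have "multiplicity_type M = p"
        using ys map_M mset_xs by (metis multiplicity_type_def mset_map)
      ultimately show "ys \<in> (\<lambda>M. map (count M) xs) `
          {M. set_mset M = B \<and> multiplicity_type M = p}"
        using map_M by blast
    qed
  qed
  then show ?thesis by (rule bij_betw_same_card)
qed

text \<open>First choose the support, which has as many elements as \<open>p\<close> has parts, then
  distribute the parts over it; the second number is multinomial and the same for every support. The
  binomial is written with \<open>gchoose\<close> over the reals because later its upper entry is a
  difference that may be negative.\<close>

lemma card_multisets_of_type:
  assumes "finite A" "0 \<notin># p"
  shows "finite {M. set_mset M \<subseteq> A \<and> multiplicity_type M = p}"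
    and "real (card {M. set_mset M \<subseteq> A \<and> multiplicity_type M = p}) =
      (real (card A) gchoose size p) * (fact (size p) / (\<Prod>k\<in>set_mset p. fact (count p k)))"
proof -
  let ?X = "\<lambda>B. {M. set_mset M = B \<and> multiplicity_type M = p}"
  let ?BS = "{B. B \<subseteq> A \<and> card B = size p}"
  have eq: "{M. set_mset M \<subseteq> A \<and> multiplicity_type M = p} = (\<Union>B\<in>?BS. ?X B)"
    by (auto simp: size_multiplicity_type)
  have card_X: "card (?X B) = card (permutations_of_multiset p)" if "B \<in> ?BS" for B
    using card_multisets_with_support_and_type[of B p] assms that finite_subset by auto
  have fin_X: "finite (?X B)" if "B \<in> ?BS" for B
  proof -
    \<comment> \<open>An infinite set has \<open>card\<close> equal to 0, so a positive cardinality
      gives finiteness.\<close>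
    have "card (permutations_of_multiset p) > 0"
      by (simp add: card_gt_0_iff)
    then show ?thesis using card_X[OF that] card_ge_0_finite by metis
  qed
  have fin_BS: "finite ?BS" using assms by auto
  show "finite {M. set_mset M \<subseteq> A \<and> multiplicity_type M = p}"
    unfolding eq using fin_BS fin_X by blast
  have "card {M. set_mset M \<subseteq> A \<and> multiplicity_type M = p} = (\<Sum>B\<in>?BS. card (?X B))"
    unfolding eq by (rule card_UN_disjoint) (use fin_BS fin_X in auto)
  also have "\<dots> = (card A choose size p) * card (permutations_of_multiset p)"
    using card_X n_subsets[OF assms(1)] by simp
  finally have "real (card {M. set_mset M \<subseteq> A \<and> multiplicity_type M = p}) =
    real (card A choose size p) * real (card (permutations_of_multiset p))" by simp
  also have "real (card (permutations_of_multiset p)) =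
    fact (size p) / (\<Prod>k\<in>set_mset p. fact (count p k))"
    using card_permutations_of_multiset[of p] by (simp add: real_of_nat_div)
  finally show "real (card {M. set_mset M \<subseteq> A \<and> multiplicity_type M = p}) =
      (real (card A) gchoose size p) * (fact (size p) / (\<Prod>k\<in>set_mset p. fact (count p k)))"
    by (simp add: binomial_gbinomial)
qed

section \<open>Counting colourings of a prescribed type on a finite vertex set\<close>

text \<open>The vertex set is a parameter: the induction runs over finite sets \<open>S\<close>,
  while the final decomposition takes all of \<open>I\<close>. Maps are extensional on
  \<open>S\<close>, so a colouring is determined by its values on \<open>S\<close> and cardinalities
  are meaningful.\<close>

definition colorings_of_type ::
  "('a \<times> 'a) set \<Rightarrow> 'c set \<Rightarrow> ('a \<Rightarrow> nat multiset) \<Rightarrow> 'a set \<Rightarrow> ('a \<Rightarrow> 'c multiset) set" where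
  "colorings_of_type E Q L S =
     {\<Gamma> \<in> S \<rightarrow>\<^sub>E {M. set_mset M \<subseteq> Q}.
        (\<forall>i\<in>S. multiplicity_type (\<Gamma> i) = L i) \<and>
        (\<forall>i\<in>S. \<forall>j\<in>S. (i, j) \<in> E \<longrightarrow> set_mset (\<Gamma> i) \<inter> set_mset (\<Gamma> j) = {})}"

text \<open>Supplies the vertex to be coloured last in the induction over finite vertex
  sets.\<close>

lemma linear_order_on_finite_has_greatest:
  assumes "linear_order_on I le" "finite S" "S \<noteq> {}" "S \<subseteq> I"
  obtains k where "k \<in> S" "\<And>i. i \<in> S \<Longrightarrow> (i, k) \<in> le"
proof -
  have refl: "(i, i) \<in> le" if "i \<in> I" for i
    using assms(1) that by (simp add: order_on_defs refl_on_def)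
  have tot: "(i, j) \<in> le \<or> (j, i) \<in> le" if "i \<in> I" "j \<in> I" for i j
    using assms(1) that refl by (cases "i = j") (auto simp: order_on_defs total_on_def)
  have trans: "trans le"
    using assms(1) by (simp add: order_on_defs)
  have "\<exists>k\<in>S. \<forall>i\<in>S. (i, k) \<in> le"
    using assms(2-4)
  proof (induction S rule: finite_ne_induct)
    case (singleton x)
    then show ?case using refl by simp
  next
    case (insert x F)
    then obtain k where k: "k \<in> F" "\<forall>i\<in>F. (i, k) \<in> le" by auto
    show ?case
    proof (cases "(x, k) \<in> le")
      case True
      then show ?thesis using k by auto
    next
      case False
      then have "(k, x) \<in> le" using tot insert.prems k(1) by blast
      then have "\<forall>i\<in>insert x F. (i, x) \<in> le"
        using k(2) refl insert.prems trans by (auto dest: transD)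
      then show ?thesis by blast
    qed
  qed
  then show ?thesis using that by blast
qed

lemma elim_clique_minus_self:
  "elim_clique I E le k - {k} = {r \<in> I - {k}. (r, k) \<in> E \<and> (r, k) \<in> le}"
  by (auto simp: elim_clique_def)

text \<open>Colouring one more vertex means choosing for it a multiset that avoids the colours of
  its neighbours. By symmetry of \<open>E\<close> it suffices to look at edges written
  \<open>(i, k)\<close>; irreflexivity excludes a loop at \<open>k\<close>, which would force the
  new multiset to be empty.\<close>

lemma bij_betw_colorings_of_type_insert:
  assumes "sym E" "irrefl E" "k \<notin> S"
  shows "bij_betw (\<lambda>(\<Gamma>, M). \<Gamma>(k := M))
    (SIGMA \<Gamma> : colorings_of_type E Q L S.
       {M. set_mset M \<subseteq> Q - (\<Union>i\<in>{i \<in> S. (i, k) \<in> E}. set_mset (\<Gamma> i)) \<and> multiplicity_type M = L k})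
    (colorings_of_type E Q L (insert k S))"
    (is "bij_betw ?f ?A ?B")
proof (rule bij_betw_byWitness[where f' = "\<lambda>\<Gamma>. (restrict \<Gamma> S, \<Gamma> k)"])
  have kk: "(k, k) \<notin> E" using assms(2) by (simp add: irrefl_def)
  show "\<forall>a\<in>?A. (restrict (?f a) S, ?f a k) = a"
  proof
    fix a assume "a \<in> ?A"
    then obtain \<Gamma> M where a: "a = (\<Gamma>, M)" "\<Gamma> \<in> colorings_of_type E Q L S" by auto
    then have "\<Gamma> \<in> extensional S"
      by (auto simp: colorings_of_type_def PiE_def)
    then have "restrict (\<Gamma>(k := M)) S = \<Gamma>"
      using assms(3) by (auto simp: restrict_def extensional_def)
    then show "(restrict (?f a) S, ?f a k) = a" using a by simp
  qed
  show "\<forall>\<Gamma>\<in>?B. ?f (restrict \<Gamma> S, \<Gamma> k) = \<Gamma>"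
    by (auto simp: colorings_of_type_def PiE_def extensional_def fun_eq_iff)
  show "?f ` ?A \<subseteq> ?B"
  proof clarify
    fix \<Gamma> M
    assume \<Gamma>: "\<Gamma> \<in> colorings_of_type E Q L S"
      and M: "set_mset M \<subseteq> Q - (\<Union>i\<in>{i \<in> S. (i, k) \<in> E}. set_mset (\<Gamma> i))"
        "multiplicity_type M = L k"
    have disj: "set_mset M \<inter> set_mset (\<Gamma> i) = {}" if "i \<in> S" "(i, k) \<in> E \<or> (k, i) \<in> E" for i
      using M(1) that assms(1) by (auto dest: symD)
    have "\<Gamma>(k := M) \<in> insert k S \<rightarrow>\<^sub>E {M. set_mset M \<subseteq> Q}"
      using \<Gamma> M(1) by (auto simp: colorings_of_type_def intro!: PiE_fun_upd)
    moreover have "\<forall>i\<in>insert k S. multiplicity_type ((\<Gamma>(k := M)) i) = L i"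
      using \<Gamma> M(2) by (auto simp: colorings_of_type_def)
    moreover have "set_mset ((\<Gamma>(k := M)) i) \<inter> set_mset ((\<Gamma>(k := M)) j) = {}"
      if ij: "i \<in> insert k S" "j \<in> insert k S" "(i, j) \<in> E" for i j
    proof -
      consider "i = k" "j = k" | "i = k" "j \<noteq> k" | "i \<noteq> k" "j = k" | "i \<noteq> k" "j \<noteq> k" by blast
      then show ?thesis
      proof cases
        case 1
        then show ?thesis using ij kk by blast
      next
        case 2
        then show ?thesis using ij disj[of j] by auto
      next
        case 3
        then show ?thesis using ij disj[of i] by auto
      next
        case 4
        then show ?thesis using ij \<Gamma> by (simp add: colorings_of_type_def)
      qed
    qed
    ultimately show "\<Gamma>(k := M) \<in> ?B"
      unfolding colorings_of_type_def by blast
  qed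
  show "(\<lambda>\<Gamma>. (restrict \<Gamma> S, \<Gamma> k)) ` ?B \<subseteq> ?A"
  proof (rule image_subsetI)
    fix \<Gamma> assume \<Gamma>: "\<Gamma> \<in> ?B"
    have "restrict \<Gamma> S \<in> colorings_of_type E Q L S"
      using \<Gamma> by (auto simp: colorings_of_type_def)
    moreover have "set_mset (\<Gamma> k) \<subseteq> Q"
      using \<Gamma> by (auto simp: colorings_of_type_def)
    moreover have "set_mset (\<Gamma> k) \<inter> set_mset (restrict \<Gamma> S i) = {}" if "i \<in> S" "(i, k) \<in> E" for i
      using \<Gamma> that by (auto simp: colorings_of_type_def)
    moreover have "multiplicity_type (\<Gamma> k) = L k"
      using \<Gamma> by (simp add: colorings_of_type_def)
    ultimately show "(restrict \<Gamma> S, \<Gamma> k) \<in> ?A" by auto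
  qed
qed

text \<open>Remove the greatest vertex \<open>k\<close>. Its neighbours in \<open>S\<close> are
  earlier, hence pairwise adjacent, so the number of colours blocked at \<open>k\<close> depends
  only on \<open>L\<close> and not on the colouring of the rest. All fibres over the smaller set
  therefore have equal size, and the count is a product.\<close>

lemma card_colorings_of_type:
  assumes peo: "perfect_elimination_ordering I E le"
    and E: "sym E" "irrefl E"
    and Q: "finite Q"
    and S: "finite S" "S \<subseteq> I"
    and L: "\<And>i. i \<in> S \<Longrightarrow> 0 \<notin># L i"
  shows "finite (colorings_of_type E Q L S)"
    and "real (card (colorings_of_type E Q L S)) =
      (\<Prod>j\<in>S. ((real (card Q) - real (\<Sum>i\<in>(elim_clique I E le j - {j}) \<inter> S. size (L i)))
          gchoose size (L j)) *
        (fact (size (L j)) / (\<Prod>k\<in>set_mset (L j). fact (count (L j) k))))"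
proof -
  define t where "t T j = ((real (card Q) -
      real (\<Sum>i\<in>(elim_clique I E le j - {j}) \<inter> T. size (L i))) gchoose size (L j)) *
    (fact (size (L j)) / (\<Prod>k\<in>set_mset (L j). fact (count (L j) k)))" for T j
  have lin: "linear_order_on I le"
    using peo by (simp add: perfect_elimination_ordering_def)
  have "finite (colorings_of_type E Q L S) \<and>
    real (card (colorings_of_type E Q L S)) = (\<Prod>j\<in>S. t S j)"
    using S L
  \<comment> \<open>Induction over proper subsets lets the removed vertex be chosen as the greatest
    one, which insertion of an arbitrary element would not.\<close>
  proof (induction S rule: finite_psubset_induct)
    case (psubset S)
    show ?case
    proof (cases "S = {}")
      case True
      then show ?thesis by (simp add: colorings_of_type_def)
    next
      case False
      then obtain k where k: "k \<in> S" "\<And>i. i \<in> S \<Longrightarrow> (i, k) \<in> le"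
        using linear_order_on_finite_has_greatest lin psubset by metis
      define T where "T = S - {k}"
      have T: "S = insert k T" "k \<notin> T" "finite T" "T \<subset> S" "T \<subseteq> I" "k \<in> I"
        using k psubset by (auto simp: T_def)
      have IH: "finite (colorings_of_type E Q L T)"
        "real (card (colorings_of_type E Q L T)) = (\<Prod>j\<in>T. t T j)"
        using psubset.IH[of T] T psubset.prems by auto
      \<comment> \<open>All neighbours of \<open>k\<close> in \<open>T\<close> precede
        \<open>k\<close>, because \<open>k\<close> is greatest in \<open>S\<close>. So
        \<open>N\<close> is the part of the elimination clique of \<open>k\<close> that lies in
        \<open>S\<close>, without \<open>k\<close>.\<close>
      define N where "N = {i \<in> T. (i, k) \<in> E}"
      have N: "(elim_clique I E le k - {k}) \<inter> S = N"
        using T k by (auto simp: elim_clique_minus_self N_def)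
      have finN: "finite N" using T by (simp add: N_def)
      \<comment> \<open>The perfect elimination property enters here; it makes the colour sets on
        \<open>N\<close> pairwise disjoint.\<close>
      have cliqueN: "(i, j) \<in> E" if "i \<in> N" "j \<in> N" "i \<noteq> j" for i j
        using peo T(6) N that unfolding perfect_elimination_ordering_def spans_complete_def by blast
      define X where "X \<Gamma> = {M. set_mset M \<subseteq> Q - (\<Union>i\<in>N. set_mset (\<Gamma> i)) \<and>
        multiplicity_type M = L k}" for \<Gamma> :: "'a \<Rightarrow> 'b multiset"
      have bij: "bij_betw (\<lambda>(\<Gamma>, M). \<Gamma>(k := M)) (Sigma (colorings_of_type E Q L T) X)
          (colorings_of_type E Q L S)"
        using bij_betw_colorings_of_type_insert[OF E T(2), of Q L] T(1)
        by (simp add: X_def[abs_def] N_def)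
      \<comment> \<open>Claimed only for existing partial colourings. If the difference in
        \<open>t S k\<close> is negative, there is no such \<open>\<Gamma>\<close>: then
        \<open>colorings_of_type E Q L T\<close> is empty, and by the induction hypothesis the
        product over \<open>T\<close> is already 0.\<close>
      have X: "finite (X \<Gamma>)" "real (card (X \<Gamma>)) = t S k"
        if \<Gamma>: "\<Gamma> \<in> colorings_of_type E Q L T" for \<Gamma>
      proof -
        have NT: "N \<subseteq> T" by (auto simp: N_def)
        have sub: "(\<Union>i\<in>N. set_mset (\<Gamma> i)) \<subseteq> Q"
          using \<Gamma> NT by (force simp: colorings_of_type_def PiE_iff)
        have "card (\<Union>i\<in>N. set_mset (\<Gamma> i)) = (\<Sum>i\<in>N. card (set_mset (\<Gamma> i)))"
        proof (rule card_UN_disjoint)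
          show "\<forall>i\<in>N. \<forall>j\<in>N. i \<noteq> j \<longrightarrow> set_mset (\<Gamma> i) \<inter> set_mset (\<Gamma> j) = {}"
            using cliqueN \<Gamma> NT unfolding colorings_of_type_def by blast
        qed (use finN in auto)
        also have "\<dots> = (\<Sum>i\<in>N. size (L i))"
        proof (rule sum.cong)
          fix i assume "i \<in> N"
          then have "multiplicity_type (\<Gamma> i) = L i"
            using \<Gamma> NT by (auto simp: colorings_of_type_def)
          then show "card (set_mset (\<Gamma> i)) = size (L i)"
            by (metis size_multiplicity_type)
        qed simp
        finally have blocked: "card (\<Union>i\<in>N. set_mset (\<Gamma> i)) = (\<Sum>i\<in>N. size (L i))" .
        have "card (Q - (\<Union>i\<in>N. set_mset (\<Gamma> i))) = card Q - (\<Sum>i\<in>N. size (L i))"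
          using card_Diff_subset[of "\<Union>i\<in>N. set_mset (\<Gamma> i)" Q] sub Q finite_subset blocked by metis
        \<comment> \<open>The blocked colours are distinct elements of \<open>Q\<close>, so the
          truncated subtraction of naturals is exact and agrees with the real difference.\<close>
        moreover have "(\<Sum>i\<in>N. size (L i)) \<le> card Q"
          using card_mono[OF Q sub] blocked by simp
        ultimately have free: "real (card (Q - (\<Union>i\<in>N. set_mset (\<Gamma> i)))) =
            real (card Q) - real (\<Sum>i\<in>N. size (L i))"
          by (simp only: of_nat_diff)
        have "finite (Q - (\<Union>i\<in>N. set_mset (\<Gamma> i)))" "0 \<notin># L k"
          using Q psubset.prems k by auto
        note card_X = card_multisets_of_type[OF this]
        show "finite (X \<Gamma>)" using card_X(1) by (simp add: X_def)
        show "real (card (X \<Gamma>)) = t S k"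
          unfolding X_def t_def N using card_X(2) unfolding free .
      qed
      have "finite (Sigma (colorings_of_type E Q L T) X)"
        using IH X by blast
      then have fin: "finite (colorings_of_type E Q L S)"
        using bij bij_betw_finite by blast
      have "card (colorings_of_type E Q L S) = card (Sigma (colorings_of_type E Q L T) X)"
        using bij_betw_same_card[OF bij] by simp
      also have "\<dots> = (\<Sum>\<Gamma>\<in>colorings_of_type E Q L T. card (X \<Gamma>))"
        using IH(1) X(1) by (intro card_SigmaI) auto
      finally have "real (card (colorings_of_type E Q L S)) =
          real (card (colorings_of_type E Q L T)) * t S k"
        using X(2) by simp
      also have "\<dots> = t S k * (\<Prod>j\<in>T. t T j)"
        using IH(2) by simp
      \<comment> \<open>Adding \<open>k\<close> does not change the factors of the other vertices:
        \<open>k\<close> comes after each of them, so it lies in none of their elimination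
        cliques.\<close>
      also have "(\<Prod>j\<in>T. t T j) = (\<Prod>j\<in>T. t S j)"
      proof (rule prod.cong)
        fix j assume j: "j \<in> T"
        have "k \<notin> elim_clique I E le j - {j}"
        proof
          assume "k \<in> elim_clique I E le j - {j}"
          then have "(k, j) \<in> le" "k \<noteq> j" by (auto simp: elim_clique_def)
          moreover have "(j, k) \<in> le" using j k T by blast
          ultimately show False
            using lin by (auto simp: order_on_defs dest: antisymD)
        qed
        then have "(elim_clique I E le j - {j}) \<inter> T = (elim_clique I E le j - {j}) \<inter> S"
          using T(1) by blast
        then show "t T j = t S j" by (simp add: t_def)
      qed simp
      also have "t S k * (\<Prod>j\<in>T. t S j) = (\<Prod>j\<in>S. t S j)"
        using T by simp
      finally show ?thesis using fin by simp
    qed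
  qed
  then show "finite (colorings_of_type E Q L S)"
    and "real (card (colorings_of_type E Q L S)) =
      (\<Prod>j\<in>S. ((real (card Q) - real (\<Sum>i\<in>(elim_clique I E le j - {j}) \<inter> S. size (L i)))
          gchoose size (L j)) *
        (fact (size (L j)) / (\<Prod>k\<in>set_mset (L j). fact (count (L j) k))))"
    by (simp_all add: t_def)
qed

section \<open>Restriction to the support\<close>

text \<open>Only the empty multiset has empty type, so the values off \<open>S\<close> are forced;
  conversely, extending by empty multisets violates no edge condition. This reduces a possibly
  infinite graph to a finite vertex set.\<close>

lemma bij_betw_colorings_of_type_restrict:
  assumes "S \<subseteq> I" "\<And>i. i \<in> I - S \<Longrightarrow> L i = {#}"
  shows "bij_betw (\<lambda>\<Gamma>. restrict \<Gamma> S) (colorings_of_type E Q L I) (colorings_of_type E Q L S)"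
    (is "bij_betw _ ?A ?B")
proof (rule bij_betw_byWitness[where f' = "\<lambda>\<Gamma>. restrict (\<lambda>i. if i \<in> S then \<Gamma> i else {#}) I"])
  have empty: "\<Gamma> i = {#}" if "\<Gamma> \<in> ?A" "i \<in> I" "i \<notin> S" for \<Gamma> i
    using that assms(2) by (auto simp: colorings_of_type_def multiplicity_type_empty_iff)
  show "\<forall>\<Gamma>\<in>?A. restrict (\<lambda>i. if i \<in> S then restrict \<Gamma> S i else {#}) I = \<Gamma>"
  proof
    fix \<Gamma> assume \<Gamma>: "\<Gamma> \<in> ?A"
    then have "\<Gamma> \<in> extensional I" by (auto simp: colorings_of_type_def PiE_def)
    then show "restrict (\<lambda>i. if i \<in> S then restrict \<Gamma> S i else {#}) I = \<Gamma>"
      using empty[OF \<Gamma>] by (auto simp: fun_eq_iff extensional_def)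
  qed
  show "\<forall>\<Gamma>\<in>?B. restrict (restrict (\<lambda>i. if i \<in> S then \<Gamma> i else {#}) I) S = \<Gamma>"
  proof
    fix \<Gamma> assume "\<Gamma> \<in> ?B"
    then have "\<Gamma> \<in> extensional S" by (auto simp: colorings_of_type_def PiE_def)
    then show "restrict (restrict (\<lambda>i. if i \<in> S then \<Gamma> i else {#}) I) S = \<Gamma>"
      using assms(1) by (auto simp: fun_eq_iff extensional_def)
  qed
  show "(\<lambda>\<Gamma>. restrict \<Gamma> S) ` ?A \<subseteq> ?B"
  proof (rule image_subsetI)
    fix \<Gamma> assume \<Gamma>: "\<Gamma> \<in> ?A"
    have "i \<in> I" if "i \<in> S" for i
      using that assms(1) by blast
    then show "restrict \<Gamma> S \<in> ?B"
      using \<Gamma> by (simp add: colorings_of_type_def PiE_iff)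
  qed
  show "(\<lambda>\<Gamma>. restrict (\<lambda>i. if i \<in> S then \<Gamma> i else {#}) I) ` ?B \<subseteq> ?A"
  proof (rule image_subsetI)
    fix \<Gamma> assume \<Gamma>: "\<Gamma> \<in> ?B"
    let ?\<Delta> = "restrict (\<lambda>i. if i \<in> S then \<Gamma> i else {#}) I"
    have "?\<Delta> \<in> I \<rightarrow>\<^sub>E {M. set_mset M \<subseteq> Q}"
      using \<Gamma> by (simp add: colorings_of_type_def PiE_iff)
    moreover have "multiplicity_type (?\<Delta> i) = L i" if "i \<in> I" for i
      using \<Gamma> assms(2)[of i] that
      by (cases "i \<in> S") (simp_all add: colorings_of_type_def multiplicity_type_empty_iff)
    moreover have "set_mset (?\<Delta> i) \<inter> set_mset (?\<Delta> j) = {}" if "i \<in> I" "j \<in> I" "(i, j) \<in> E" for i j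
      using \<Gamma> that by (simp add: colorings_of_type_def)
    ultimately show "?\<Delta> \<in> ?A"
      unfolding colorings_of_type_def by blast
  qed
qed

section \<open>Finiteness of the set of partition tuples\<close>

lemma partitions_of_0: "partitions_of 0 = {{#}}"
proof -
  have "p = {#}" if "0 \<notin># p" "sum_mset p = 0" for p :: "nat multiset"
    using that by (metis multiset_nonemptyE sum_mset_0_iff)
  then show ?thesis by (auto simp: partitions_of_def)
qed

text \<open>All parts are positive, so both the number of parts and each part are at most
  \<open>n\<close>.\<close>

lemma finite_partitions_of: "finite (partitions_of n)"
proof (rule finite_subset)
  show "partitions_of n \<subseteq> (\<Union>s\<le>n. multisets_of_size {..n} s)"
  proof
    fix p assume p: "p \<in> partitions_of n"
    have "size p \<le> sum_mset p" if "0 \<notin># p" for p :: "nat multiset"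
      using that by (induction p) auto
    then have "size p \<le> n" using p by (auto simp: partitions_of_def)
    moreover have "x \<le> n" if "x \<in># p" for x
      using p that by (auto simp: partitions_of_def dest!: multi_member_split)
    ultimately show "p \<in> (\<Union>s\<le>n. multisets_of_size {..n} s)"
      by (auto simp: multisets_of_size_def)
  qed
  show "finite (\<Union>s\<le>n. multisets_of_size {..n} s)"
    by auto
qed

lemma partition_tuples_outside_supp:
  assumes "L \<in> partition_tuples I I1it m" "i \<in> I - supp_on I m"
  shows "L i = {#}"
proof -
  have "L i \<in> partitions_of (m i)"
    using assms by (simp add: partition_tuples_def PiE_iff)
  moreover have "m i = 0"
    using assms(2) by (simp add: supp_on_def)
  ultimately show ?thesis by (simp add: partitions_of_0)
qed

text \<open>A tuple is determined by its entries on the support, since 0 has only the empty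
  partition, and a finite product of finite sets is finite.\<close>

lemma finite_partition_tuples:
  assumes "finite (supp_on I m)"
  shows "finite (partition_tuples I I1it m)"
proof (rule inj_on_finite[where f = "\<lambda>L. restrict L (supp_on I m)"])
  show "inj_on (\<lambda>L. restrict L (supp_on I m)) (partition_tuples I I1it m)"
  proof (rule inj_onI)
    fix L K
    assume L: "L \<in> partition_tuples I I1it m" and K: "K \<in> partition_tuples I I1it m"
      and eq: "restrict L (supp_on I m) = restrict K (supp_on I m)"
    show "L = K"
    proof (rule PiE_ext)
      show "L \<in> (\<Pi>\<^sub>E i\<in>I. partitions_of (m i))" "K \<in> (\<Pi>\<^sub>E i\<in>I. partitions_of (m i))"
        using L K by (auto simp: partition_tuples_def)
      fix i assume "i \<in> I"
      then show "L i = K i"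
        using fun_cong[OF eq, of i] partition_tuples_outside_supp[OF L, of i]
          partition_tuples_outside_supp[OF K, of i]
        by (cases "i \<in> supp_on I m") auto
    qed
  qed
  show "(\<lambda>L. restrict L (supp_on I m)) ` partition_tuples I I1it m
      \<subseteq> (\<Pi>\<^sub>E i\<in>supp_on I m. partitions_of (m i))"
  proof (rule image_subsetI)
    fix L assume "L \<in> partition_tuples I I1it m"
    then have "L i \<in> partitions_of (m i)" if "i \<in> supp_on I m" for i
      using that by (simp add: partition_tuples_def PiE_iff supp_on_def)
    then show "restrict L (supp_on I m) \<in> (\<Pi>\<^sub>E i\<in>supp_on I m. partitions_of (m i))"
      by (simp add: PiE_iff)
  qed
  show "finite (\<Pi>\<^sub>E i\<in>supp_on I m. partitions_of (m i))"
    using assms finite_partitions_of by (intro finite_PiE) auto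
qed

section \<open>Decomposition of the colourings by type\<close>

text \<open>Each colouring lies in the class of its own types. The conditions on sizes and on the
  marking depend only on the type and become membership in \<open>partition_tuples\<close>; the
  colour range and the edge condition carry over unchanged.\<close>

lemma marked_multicolorings_eq_Union:
  "marked_multicolorings I E I1it m q =
    (\<Union>L\<in>partition_tuples I I1it m. colorings_of_type E {1..q} L I)"
proof (intro equalityI subsetI)
  fix \<Gamma> assume \<Gamma>: "\<Gamma> \<in> marked_multicolorings I E I1it m q"
  define L where "L = restrict (\<lambda>i. multiplicity_type (\<Gamma> i)) I"
  have "L i \<in> partitions_of (m i)" if "i \<in> I" for i
    using \<Gamma> that by (simp add: L_def partitions_of_def zero_notin_multiplicity_type
        sum_multiplicity_type marked_multicolorings_def)
  moreover have "L i = replicate_mset (m i) 1" if "i \<in> I - I1it" for i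
    using \<Gamma> that multiplicity_type_eq_replicate_iff[of "\<Gamma> i" "m i"]
    by (simp add: L_def marked_multicolorings_def)
  ultimately have "L \<in> partition_tuples I I1it m"
    by (auto simp: partition_tuples_def L_def)
  moreover have "\<Gamma> \<in> colorings_of_type E {1..q} L I"
    using \<Gamma> by (auto simp: L_def marked_multicolorings_def colorings_of_type_def)
  ultimately show "\<Gamma> \<in> (\<Union>L\<in>partition_tuples I I1it m. colorings_of_type E {1..q} L I)"
    by blast
next
  fix \<Gamma> assume "\<Gamma> \<in> (\<Union>L\<in>partition_tuples I I1it m. colorings_of_type E {1..q} L I)"
  then obtain L where L: "L \<in> partition_tuples I I1it m"
    and \<Gamma>: "\<Gamma> \<in> colorings_of_type E {1..q} L I" by blast
  have type: "multiplicity_type (\<Gamma> i) = L i" if "i \<in> I" for i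
    using \<Gamma> that by (simp add: colorings_of_type_def)
  have "size (\<Gamma> i) = m i" if "i \<in> I" for i
  proof -
    have "L i \<in> partitions_of (m i)" using L that by (auto simp: partition_tuples_def)
    then show ?thesis
      using type[OF that] sum_multiplicity_type[of "\<Gamma> i"] by (simp add: partitions_of_def)
  qed
  moreover have "count (\<Gamma> i) c \<le> 1" if "i \<in> I - I1it" for i c
  proof -
    have "multiplicity_type (\<Gamma> i) = replicate_mset (m i) 1"
      using L that type[of i] by (simp add: partition_tuples_def)
    then show ?thesis by (simp only: multiplicity_type_eq_replicate_iff)
  qed
  ultimately show "\<Gamma> \<in> marked_multicolorings I E I1it m q"
    using \<Gamma> by (simp add: marked_multicolorings_def colorings_of_type_def)
qed

section \<open>The infinite product and the final formula\<close>

text \<open>All but finitely many factors are 0! = 1. The product over positive \<open>k\<close> is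
  indexed from 0 through \<open>Suc\<close>, and since 0 is not a part, no part is missed.\<close>

lemma prodinf_fact_count:
  assumes "0 \<notin># p"
  shows "(\<Prod>k. fact (count p (Suc k)) :: real) = (\<Prod>k\<in>set_mset p. fact (count p k))"
proof -
  have im: "Suc ` {k. Suc k \<in># p} = set_mset p"
  proof (intro equalityI subsetI)
    fix x assume "x \<in># p"
    then show "x \<in> Suc ` {k. Suc k \<in># p}" using assms by (cases x) auto
  qed auto
  then have fin: "finite {k. Suc k \<in># p}"
    by (metis finite_imageD finite_set_mset inj_Suc)
  have "(\<Prod>k. fact (count p (Suc k)) :: real) = (\<Prod>k\<in>{k. Suc k \<in># p}. fact (count p (Suc k)))"
    using fin by (intro prodinf_finite) (auto simp: not_in_iff)
  also have "\<dots> = (\<Prod>k\<in>Suc ` {k. Suc k \<in># p}. fact (count p k))"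
    by (subst prod.reindex) auto
  finally show ?thesis unfolding im .
qed

theorem theorem3p7:
  fixes I I1 I1it :: "'a set" and E :: "('a \<times> 'a) set" and le :: "'a rel"
    and m :: "'a \<Rightarrow> nat" and q :: nat
  assumes "countable I"
    and "marked_graph I E I1 I1it"
    and "perfect_elimination_ordering I E le"
    and "finite (supp_on I m)"
  shows "real (marked_chromatic I E I1it m q) =
    (\<Sum>L\<in>partition_tuples I I1it m. \<Prod>j\<in>supp_on I m.
       ((real q - real (clique_length_sum I E le L j)) gchoose size (L j)) *
       (fact (size (L j)) / (\<Prod>k. fact (count (L j) (Suc k)))))"
proof -
  let ?S = "supp_on I m" and ?C = "\<lambda>L. colorings_of_type E {1..q} L I"
  have E: "sym E" "irrefl E"
    using assms(2) by (auto simp: marked_graph_def simple_graph_def)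
  have S: "?S \<subseteq> I" by (auto simp: supp_on_def)
  have C: "finite (?C L) \<and> real (card (?C L)) = (\<Prod>j\<in>?S.
       ((real q - real (clique_length_sum I E le L j)) gchoose size (L j)) *
       (fact (size (L j)) / (\<Prod>k. fact (count (L j) (Suc k)))))"
    if L: "L \<in> partition_tuples I I1it m" for L
  proof -
    have bij: "bij_betw (\<lambda>\<Gamma>. restrict \<Gamma> ?S) (?C L) (colorings_of_type E {1..q} L ?S)"
      using bij_betw_colorings_of_type_restrict[OF S] partition_tuples_outside_supp[OF L] by blast
    have pos: "0 \<notin># L i" if "i \<in> ?S" for i
    proof -
      have "L i \<in> partitions_of (m i)" using L that S by (auto simp: partition_tuples_def)
      then show ?thesis by (simp add: partitions_of_def)
    qed
    \<comment> \<open>Clique members outside the support have the empty partition and contribute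
      length 0.\<close>
    have sum: "(\<Sum>i\<in>(elim_clique I E le j - {j}) \<inter> ?S. size (L i)) = clique_length_sum I E le L j"
      if "j \<in> ?S" for j
      unfolding clique_length_sum_def
    proof (rule sum.mono_neutral_left)
      show "finite (elim_clique I E le j - {j})"
        using assms(3) that S by (auto simp: perfect_elimination_ordering_def)
      show "\<forall>i\<in>elim_clique I E le j - {j} - (elim_clique I E le j - {j}) \<inter> ?S. size (L i) = 0"
        using partition_tuples_outside_supp[OF L] by (auto simp: elim_clique_def)
    qed auto
    note card = card_colorings_of_type[where Q = "{1..q}" and L = L,
        OF assms(3) E finite_atLeastAtMost assms(4) S pos]
    have "real (card (?C L)) = real (card (colorings_of_type E {1..q} L ?S))"
      using bij_betw_same_card[OF bij] by simp
    also have "\<dots> = (\<Prod>j\<in>?S.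
       ((real q - real (clique_length_sum I E le L j)) gchoose size (L j)) *
       (fact (size (L j)) / (\<Prod>k. fact (count (L j) (Suc k)))))"
      using card(2) by (simp add: sum prodinf_fact_count pos cong: prod.cong)
    finally show ?thesis
      using card(1) bij_betw_finite[OF bij] by blast
  qed
  have "marked_chromatic I E I1it m q = (\<Sum>L\<in>partition_tuples I I1it m. card (?C L))"
    unfolding marked_chromatic_def marked_multicolorings_eq_Union
  proof (rule card_UN_disjoint)
    show "finite (partition_tuples I I1it m)"
      using finite_partition_tuples[OF assms(4)] .
    show "\<forall>L\<in>partition_tuples I I1it m. finite (?C L)"
      using C by blast
    \<comment> \<open>A colouring determines its type at every vertex of \<open>I\<close>, and
      tuples are extensional on \<open>I\<close>, so different tuples have disjoint classes.\<close>
    show "\<forall>L\<in>partition_tuples I I1it m. \<forall>K\<in>partition_tuples I I1it m.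
        L \<noteq> K \<longrightarrow> ?C L \<inter> ?C K = {}"
    proof (intro ballI impI)
      fix L K assume "L \<in> partition_tuples I I1it m" "K \<in> partition_tuples I I1it m" "L \<noteq> K"
      moreover have "L = K" if "\<Gamma> \<in> ?C L" "\<Gamma> \<in> ?C K"
        "L \<in> partition_tuples I I1it m" "K \<in> partition_tuples I I1it m" for \<Gamma>
      proof (rule PiE_ext)
        show "L \<in> (\<Pi>\<^sub>E i\<in>I. partitions_of (m i))" "K \<in> (\<Pi>\<^sub>E i\<in>I. partitions_of (m i))"
          using that by (auto simp: partition_tuples_def)
        show "L i = K i" if "i \<in> I" for i
          using \<open>\<Gamma> \<in> ?C L\<close> \<open>\<Gamma> \<in> ?C K\<close> that by (simp add: colorings_of_type_def)
      qed
      ultimately show "?C L \<inter> ?C K = {}" by blast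
    qed
  qed
  then show ?thesis using C by simp
qed

end
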